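(* For all $s,t>0$, $f_{s-t}$ maps $\overline{\Omega_s}$ into $\overline{\mathbb D}$. If, in addition, $s\ge\frac t2$, then $\chi_{s,t}=f_{s-t}\circ\chi_s$ is an (injective) conformal map from $\mathbb D$ onto its image $\chi_{s,t}(\mathbb D)$, which lies inside $\mathbb D$, and it extends to a homeomorphism from $\overline{\mathbb D}$ onto $\overline{\chi_{s,t}(\mathbb D)}$; furthermore, $1\notin\overline{\chi_{s,t}(\mathbb D)}$.
   Context: $\mathbb D$ is the open unit disk. For $r\in\mathbb R$ let $f_r(z)=z\exp\big(\frac r2\frac{1+z}{1-z}\big)$, $z\ne1$. For $s>0$ let $\Omega_s=\{z\in\mathbb D:f_s(z)\in\mathbb D\}$. Known (Biane): $\Omega_s$ is a Jordan domain, $1\notin\overline{\Omega_s}$, $f_s$ maps $\Omega_s$ conformally onto $\mathbb D$ and extends to a homeomorphism $\overline{\Omega_s}\to\overline{\mathbb D}$. Its inverse is denoted $\chi_s:\overline{\mathbb D}\to\overline{\Omega_s}$. *)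

theory Defs
  imports "HOL-Complex_Analysis.Complex_Analysis"
begin

text \<open>The map is only meant for arguments different from 1; the value at 1 given by the convention
  x / 0 = 0 plays no role, since 1 lies outside the closures of the domains below.\<close>

definition expf :: "real \<Rightarrow> complex \<Rightarrow> complex" where
  "expf r z = z * exp (complex_of_real (r / 2) * ((1 + z) / (1 - z)))"

definition Omega :: "real \<Rightarrow> complex set" where
  "Omega s = {z \<in> ball 0 1. expf s z \<in> ball 0 1}"

text \<open>By a theorem of Biane, for positive s the map \<open>expf s\<close> is a homeomorphism from the closure of
  \<open>Omega s\<close> onto the closed unit disk; \<open>chi s\<close> is its inverse, meaningful on the closed disk.\<close>

definition chi :: "real \<Rightarrow> complex \<Rightarrow> complex" where
  "chi s = the_inv_into (closure (Omega s)) (expf s)"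

definition chi2 :: "real \<Rightarrow> real \<Rightarrow> complex \<Rightarrow> complex" where
  "chi2 s t = expf (s - t) \<circ> chi s"

text \<open>Intended for open \<open>U\<close>. The condition on the derivative is implied by injectivity; it is listed
  so that the definition entails conformality in the local sense as well.\<close>

definition injective_conformal_on :: "(complex \<Rightarrow> complex) \<Rightarrow> complex set \<Rightarrow> bool" where
  "injective_conformal_on g U \<longleftrightarrow>
     g holomorphic_on U \<and> inj_on g U \<and> (\<forall>z\<in>U. deriv g z \<noteq> 0)"

end

theory Submission imports Defs begin

text \<open>Write \<open>\<rho> = |z| = exp (- p)\<close>. The condition \<open>|f\<^sub>s(z)| \<le> 1\<close> on the closure of \<open>\<Omega>\<^sub>s\<close> says
  \<open>|1 - z|\<^sup>2 \<ge> s \<rho> sinh p / p\<close>. If \<open>f\<^sub>r(z) = f\<^sub>r(w)\<close>, then \<open>z = w exp a\<close> with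
  \<open>a = r (w - z) / ((1 - z) (1 - w))\<close>, hence \<open>|z - w|\<^sup>2 = 4 |z| |w| |sinh (a / 2)|\<^sup>2\<close>. Comparing this with
  the lower bounds for \<open>|1 - z|\<close> and \<open>|1 - w|\<close> forces \<open>|r| > s\<close> unless \<open>z = w\<close>, so \<open>f\<^sub>r\<close> is injective on the
  closure of \<open>\<Omega>\<^sub>s\<close> whenever \<open>|r| \<le> s\<close>. The case \<open>r = s\<close>, together with the fact that \<open>f\<^sub>s\<close>
  maps the frontier of \<open>\<Omega>\<^sub>s\<close> to the unit circle, gives Biane's theorem; the case \<open>r = s - t\<close> gives
  the injectivity of \<open>\<chi>\<^sub>s\<^sub>,\<^sub>t\<close> up to the boundary, and the condition \<open>|s - t| \<le> s\<close> is exactly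
  \<open>s \<ge> t / 2\<close>. Finally, \<open>f\<^bsub>s-t\<^esub>(z) = 1\<close> would force \<open>|z| = 1\<close> and \<open>z = exp (- i b)\<close> with
  \<open>|b| \<le> |sin b|\<close>.\<close>

section \<open>The hyperbolic cardinal sine\<close>

text \<open>The value at 0 is the limit, so points of modulus 1, where
  \<open>- ln (norm z) = 0\<close>, are covered by the same formulas.\<close>

definition sinhc :: "real \<Rightarrow> real" where
  "sinhc x = (if x = 0 then 1 else sinh x / x)"

lemma sinhc_mult: "sinhc x * x = sinh x"
  by (simp add: sinhc_def)

lemma sinhc_minus [simp]: "sinhc (- x) = sinhc x"
  by (simp add: sinhc_def)

lemma sinh_less_mult_cosh:
  fixes x :: real
  assumes "x > 0"
  shows "sinh x < x * cosh x"
proof -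
  have "\<exists>y. ((\<lambda>x. x * cosh x - sinh x) has_real_derivative y) (at u) \<and> y > 0"
    if "0 < u" "u < x" for u :: real
    using that by (intro exI[of _ "u * sinh u"] conjI) (auto intro!: derivative_eq_intros)
  moreover have "continuous_on {0..x} (\<lambda>x. x * cosh x - sinh x)"
    by (intro continuous_intros)
  ultimately show ?thesis
    using DERIV_pos_imp_increasing_open[OF assms, of "\<lambda>x. x * cosh x - sinh x"] by simp
qed

lemma sinhc_ge_1: "sinhc x \<ge> 1"
proof -
  have "sinhc x \<ge> 1" if "x > 0" for x
  proof -
    have "\<exists>y. ((\<lambda>x. sinh x - x) has_real_derivative y) (at u) \<and> y \<ge> 0" for u :: real
      by (intro exI[of _ "cosh u - 1"] conjI)
        (auto intro!: derivative_eq_intros simp: cosh_real_ge_1)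
    then have "x \<le> sinh x"
      using DERIV_nonneg_imp_nondecreasing[of 0 x "\<lambda>x. sinh x - x"] that by simp
    then show ?thesis using that by (simp add: sinhc_def)
  qed
  from this[of x] this[of "-x"] show ?thesis
    by (cases x "0::real" rule: linorder_cases) (auto simp: sinhc_def)
qed

lemma sinhc_mono:
  assumes "0 \<le> x" "x \<le> y"
  shows "sinhc x \<le> sinhc y"
proof (cases "x = 0")
  case True
  then show ?thesis using sinhc_ge_1[of y] by (simp add: sinhc_def)
next
  case False
  have "\<exists>v. ((\<lambda>x. sinh x / x) has_real_derivative v) (at u) \<and> v \<ge> 0"
    if "x \<le> u" for u :: real
  proof (intro exI conjI)
    show "((\<lambda>x. sinh x / x) has_real_derivative (cosh u * u - sinh u) / (u * u)) (at u)"
      using that False assms by (auto intro!: derivative_eq_intros)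
    show "(cosh u * u - sinh u) / (u * u) \<ge> 0"
      using sinh_less_mult_cosh[of u] that False assms by (simp add: mult.commute)
  qed
  then have "sinh x / x \<le> sinh y / y"
    using DERIV_nonneg_imp_nondecreasing[of x y "\<lambda>x. sinh x / x"] assms by blast
  then show ?thesis using False assms by (simp add: sinhc_def)
qed

text \<open>With \<open>y = x / 2\<close>, the duplication formula gives
  \<open>sinhc x = sinhc y * cosh y\<close>, and \<open>sinhc y < cosh y\<close>.\<close>

lemma sinhc_half_squared_less:
  assumes "x > 0"
  shows "(sinhc (x / 2))\<^sup>2 < sinhc x"
proof -
  define y where "y = x / 2"
  have y: "y > 0" "x = 2 * y" using assms by (auto simp: y_def)
  have "sinh y * sinh y < sinh y * (y * cosh y)"
    using sinh_less_mult_cosh[OF y(1)] y(1) by simp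
  then have "sinh y * sinh y / (y * y) < sinh y * (y * cosh y) / (y * y)"
    using y(1) by (intro divide_strict_right_mono) auto
  also have "\<dots> = sinhc x" using y by (simp add: sinhc_def sinh_double)
  finally show ?thesis
    using y by (simp add: y_def[symmetric] sinhc_def power2_eq_square)
qed

text \<open>By symmetry let \<open>q \<le> p\<close>. Then \<open>(p - q) / 2 \<le> p / 2\<close>,
  so monotonicity reduces the claim to the previous bound, and \<open>sinhc q\<close> is at least 1.
  Strictness matters for injectivity in the limiting case \<open>\<bar>r\<bar> = s\<close>.\<close>

lemma sinhc_half_diff_squared_less:
  assumes "p \<ge> 0" "q \<ge> 0" "p \<noteq> 0 \<or> q \<noteq> 0"
  shows "(sinhc ((p - q) / 2))\<^sup>2 < sinhc p * sinhc q"
proof -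
  have *: "(sinhc ((p - q) / 2))\<^sup>2 < sinhc p * sinhc q"
    if "0 \<le> q" "q \<le> p" "0 < p" for p q
  proof -
    have "(sinhc ((p - q) / 2))\<^sup>2 \<le> (sinhc (p / 2))\<^sup>2"
      using that sinhc_ge_1[of "(p - q) / 2"] by (intro power_mono sinhc_mono) auto
    also have "\<dots> < sinhc p" using sinhc_half_squared_less that by simp
    also have "\<dots> \<le> sinhc p * sinhc q"
      using sinhc_ge_1[of p] sinhc_ge_1[of q] by simp
    finally show ?thesis .
  qed
  have sym: "sinhc ((p - q) / 2) = sinhc ((q - p) / 2)"
    using sinhc_minus[of "(p - q) / 2"] by (simp add: minus_divide_left)
  show ?thesis
  proof (cases "q \<le> p")
    case True
    then show ?thesis using * assms by simp
  next
    case False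
    then show ?thesis using *[of p q] assms
      by (simp add: sym mult.commute)
  qed
qed

section \<open>Size of the complex hyperbolic sine\<close>

lemma norm_sinh_squared:
  "(norm (sinh z))\<^sup>2 = (sinh (Re z))\<^sup>2 + (sin (Im z))\<^sup>2"
proof -
  define x y where "x = Re z" and "y = Im z"
  have *: "Re (sinh z) = sinh x * cos y" "Im (sinh z) = cosh x * sin y"
    by (simp_all add: sinh_def cosh_def Re_exp Im_exp x_def y_def algebra_simps)
  have "(norm (sinh z))\<^sup>2 = (sinh x * cos y)\<^sup>2 + (cosh x * sin y)\<^sup>2"
    by (simp add: cmod_power2 *)
  also have "\<dots> = (sinh x)\<^sup>2 * (cos y)\<^sup>2 + ((sinh x)\<^sup>2 + 1) * (sin y)\<^sup>2"
    by (simp add: power_mult_distrib cosh_square_eq)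
  also have "\<dots> = (sinh x)\<^sup>2 * ((sin y)\<^sup>2 + (cos y)\<^sup>2) + (sin y)\<^sup>2"
    by (simp add: algebra_simps del: sin_cos_squared_add sin_cos_squared_add2)
  finally show ?thesis by (simp add: x_def y_def)
qed

text \<open>For 0 < x < pi the duplication formula brings in the factor
  \<open>cos (x / 2) < 1\<close>, the source of strictness; from pi on, the bound 1 on the sine
  suffices.\<close>

lemma abs_sin_less_abs:
  fixes x :: real
  assumes "x \<noteq> 0"
  shows "\<bar>sin x\<bar> < \<bar>x\<bar>"
proof -
  have *: "\<bar>sin x\<bar> < x" if "x > 0" for x :: real
  proof (cases "x < pi")
    case True
    define y where "y = x / 2"
    have y: "0 < y" "y < pi / 2" "x = 2 * y" using that True by (auto simp: y_def)
    have "sin y > 0" "cos y > 0" using y by (auto intro!: sin_gt_zero2 cos_gt_zero)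
    have "cos y < 1" using cos_monotone_0_pi[of 0 y] y pi_gt_zero by (simp del: pi_gt_zero)
    have "\<bar>sin x\<bar> = 2 * (sin y * cos y)"
      using \<open>sin y > 0\<close> \<open>cos y > 0\<close> by (simp add: y(3) sin_double abs_mult)
    also have "\<dots> < 2 * sin y" using \<open>sin y > 0\<close> \<open>cos y < 1\<close> by simp
    also have "\<dots> \<le> x" using sin_x_le_x[of y] y by simp
    finally show ?thesis .
  next
    case False
    then show ?thesis using abs_sin_le_one[of x] pi_gt3 by linarith
  qed
  from *[of x] *[of "-x"] assms show ?thesis
    by (cases x "0::real" rule: linorder_cases) auto
qed

text \<open>The two summands compare separately: the one with the real part is an equality, the
  other uses |sin y| \<le> |y| and \<open>sinhc \<ge> 1\<close>.\<close>

lemma norm_sinh_squared_le: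
  "(norm (sinh z))\<^sup>2 \<le> (sinhc (Re z))\<^sup>2 * (norm z)\<^sup>2"
proof -
  have "(sin (Im z))\<^sup>2 \<le> (Im z)\<^sup>2"
    using abs_sin_x_le_abs_x by (simp add: abs_le_square_iff)
  also have "\<dots> \<le> (sinhc (Re z))\<^sup>2 * (Im z)\<^sup>2"
    using mult_right_mono[OF one_le_power[OF sinhc_ge_1[of "Re z"]], of "(Im z)\<^sup>2" 2] by simp
  finally show ?thesis
    unfolding norm_sinh_squared sinhc_mult[symmetric] cmod_power2[of z]
    by (simp add: power_mult_distrib distrib_left)
qed

section \<open>Modulus of the map and closure of the domain\<close>

text \<open>This is the Poisson kernel of the disk for the boundary point 1; it governs the modulus
  of \<open>expf\<close>.\<close>

lemma Re_Cayley:
  "Re ((1 + z) / (1 - z)) = (1 - (norm z)\<^sup>2) / (norm (1 - z))\<^sup>2"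
  by (simp add: Re_divide cmod_power2) (simp add: power2_eq_square algebra_simps)

lemma norm_expf:
  "norm (expf r z) = norm z * exp (r / 2 * ((1 - (norm z)\<^sup>2) / (norm (1 - z))\<^sup>2))"
proof -
  have "Re (complex_of_real (r / 2) * ((1 + z) / (1 - z))) = r / 2 * Re ((1 + z) / (1 - z))"
    by (simp only: times_complex.sel Re_complex_of_real Im_complex_of_real mult_zero_left diff_zero)
  then show ?thesis
    by (simp only: expf_def norm_mult norm_exp_eq_Re Re_Cayley)
qed

lemma norm_expf_diff:
  "norm (expf (s - t) z) =
     norm (expf s z) * exp (- (t / 2 * ((1 - (norm z)\<^sup>2) / (norm (1 - z))\<^sup>2)))"
  unfolding norm_expf mult.assoc exp_add[symmetric]
  by (simp add: diff_divide_distrib left_diff_distrib)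

text \<open>Lowering the parameter by \<open>t\<close> multiplies the modulus by the exponential of
  \<open>- t / 2\<close> times the Poisson kernel, which is nonnegative on the closed disk.\<close>

lemma norm_expf_diff_le:
  assumes "t > 0" "norm z \<le> 1"
  shows "norm (expf (s - t) z) \<le> norm (expf s z)"
proof -
  have "(1 - (norm z)\<^sup>2) / (norm (1 - z))\<^sup>2 \<ge> 0"
    using assms by (simp add: power_le_one)
  then have "t / 2 * ((1 - (norm z)\<^sup>2) / (norm (1 - z))\<^sup>2) \<ge> 0"
    using assms by (intro mult_nonneg_nonneg[of "t / 2"]) auto
  then show ?thesis
    unfolding norm_expf_diff by (intro mult_left_le) (simp_all only: exp_le_one_iff norm_ge_zero neg_le_0_iff_le)
qed

lemma norm_expf_unit: "norm z = 1 \<Longrightarrow> norm (expf r z) = 1"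
  by (simp add: norm_expf)

lemma expf_0 [simp]: "expf r 0 = 0"
  by (simp add: expf_def)

lemma expf_eq_0_iff [simp]: "expf r z = 0 \<longleftrightarrow> z = 0"
  by (simp add: expf_def)

lemma continuous_on_expf: "1 \<notin> A \<Longrightarrow> continuous_on A (expf r)"
  unfolding expf_def by (intro continuous_intros) auto

lemma holomorphic_on_expf: "1 \<notin> A \<Longrightarrow> expf r holomorphic_on A"
  unfolding expf_def by (intro holomorphic_intros) auto

section \<open>Distance of the domain from the point 1\<close>

text \<open>Squaring \<open>norm z * exp X < 1\<close> and using
  \<open>1 + 2 * X \<le> exp (2 * X)\<close> lets the factor \<open>1 - n\<close> cancel. The
  resulting inequality fails at 1 and survives limits, which keeps the closure away from the
  singularity.\<close>

lemma Omega_dist_1: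
  assumes "s > 0" "z \<in> Omega s"
  shows "s * (norm z)\<^sup>2 \<le> (norm (1 - z))\<^sup>2"
proof -
  define n d where "n = (norm z)\<^sup>2" and "d = (norm (1 - z))\<^sup>2"
  define X where "X = s / 2 * ((1 - n) / d)"
  have z: "norm z < 1" and f: "norm z * exp X < 1"
    using assms norm_expf[of s z] by (auto simp: Omega_def X_def n_def d_def)
  have n: "0 \<le> n" "n < 1" using z by (auto simp: n_def power_less_one_iff abs_square_less_1)
  have "z \<noteq> 1" using z by auto
  then have d: "d > 0" by (simp add: d_def)
  have "(norm z * exp X)\<^sup>2 < 1" using f by (simp add: abs_square_less_1)
  then have "n * exp (2 * X) < 1" by (simp add: n_def power_mult_distrib exp_double)
  moreover have "n * (1 + 2 * X) \<le> n * exp (2 * X)"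
    using n by (intro mult_left_mono) auto
  ultimately have "n * (2 * X) < 1 - n" by (simp add: algebra_simps)
  then have "(n * s / d) * (1 - n) < 1 * (1 - n)"
    by (simp add: X_def diff_divide_distrib algebra_simps)
  then have "n * s / d < 1" using n by (simp only: mult_less_cancel_right_pos diff_gt_0_iff_gt)
  then show ?thesis using d by (simp add: field_simps flip: n_def d_def)
qed

text \<open>The closed set \<open>C\<close> misses 1, so \<open>expf s\<close> is continuous on it
  and the part of \<open>C\<close> sent into the closed disk is closed. That part contains
  \<open>Omega s\<close>, hence also its closure.\<close>

lemma closure_Omega_props:
  assumes s: "s > 0" and z: "z \<in> closure (Omega s)"
  shows closure_Omega_norm: "norm z \<le> 1"
    and closure_Omega_dist_1: "s * (norm z)\<^sup>2 \<le> (norm (1 - z))\<^sup>2"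
    and closure_Omega_neq_1: "z \<noteq> 1"
    and closure_Omega_expf: "norm (expf s z) \<le> 1"
proof -
  define C where "C = {z :: complex. norm z \<le> 1 \<and> s * (norm z)\<^sup>2 \<le> (norm (1 - z))\<^sup>2}"
  have C: "closed C" unfolding C_def
    by (intro closed_Collect_conj closed_Collect_le continuous_intros)
  have 1: "1 \<notin> C" using s by (auto simp: C_def)
  have "closed (C \<inter> expf s -` cball 0 1)"
    using continuous_on_expf[OF 1] C closed_cball by (rule continuous_closed_preimage)
  moreover have "Omega s \<subseteq> C \<inter> expf s -` cball 0 1"
    using Omega_dist_1[OF s] by (auto simp: C_def Omega_def)
  ultimately have "z \<in> C \<inter> expf s -` cball 0 1"
    using z closure_minimal by blast
  then show "norm z \<le> 1" "s * (norm z)\<^sup>2 \<le> (norm (1 - z))\<^sup>2"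
      "z \<noteq> 1" "norm (expf s z) \<le> 1"
    using 1 by (auto simp: C_def)
qed

text \<open>Inside the disk, take logarithms in \<open>norm (expf s z) \<le> 1\<close> and use
  \<open>\<rho> * sinhc p = (1 - \<rho>\<^sup>2) / (2 * p)\<close>. On the unit circle the cruder
  bound already says the same.\<close>

lemma closure_Omega_dist_1_sinhc:
  assumes s: "s > 0" and z: "z \<in> closure (Omega s)" and "z \<noteq> 0"
  shows "s * norm z * sinhc (- ln (norm z)) \<le> (norm (1 - z))\<^sup>2"
proof (cases "norm z = 1")
  case True
  then show ?thesis using closure_Omega_dist_1[OF s z] by (simp add: sinhc_def)
next
  case False
  define \<rho> p d where "\<rho> = norm z" and "p = - ln (norm z)" and "d = (norm (1 - z))\<^sup>2"
  have \<rho>: "0 < \<rho>" "\<rho> < 1" using assms False closure_Omega_norm[OF s z] by (auto simp: \<rho>_def)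
  have p: "p > 0" using \<rho> by (simp add: p_def \<rho>_def)
  have ep: "exp p = 1 / \<rho>" "exp (- p) = \<rho>"
    using \<rho> by (simp_all add: p_def \<rho>_def exp_minus divide_inverse)
  have d: "d > 0" using closure_Omega_neq_1[OF s z] by (simp add: d_def)
  have "\<rho> * exp (s / 2 * ((1 - \<rho>\<^sup>2) / d)) \<le> 1"
    using closure_Omega_expf[OF s z] unfolding norm_expf by (simp add: \<rho>_def d_def)
  then have "exp (s / 2 * ((1 - \<rho>\<^sup>2) / d)) \<le> exp p"
    using \<rho> by (simp add: ep field_simps)
  then have "s / 2 * ((1 - \<rho>\<^sup>2) / d) \<le> p" by simp
  then have "s * ((1 - \<rho>\<^sup>2) / (2 * p)) \<le> d"
    using d p by (simp add: field_simps)
  moreover have "\<rho> * sinhc p = (1 - \<rho>\<^sup>2) / (2 * p)"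
    using p \<rho> by (simp add: sinhc_def sinh_def ep field_simps power2_eq_square)
  ultimately show ?thesis by (simp add: \<rho>_def p_def d_def mult.assoc)
qed

section \<open>Injectivity\<close>

lemma inj_on_expf:
  assumes s: "s > 0" and r: "\<bar>r\<bar> \<le> s"
  shows "inj_on (expf r) (closure (Omega s))"
proof (rule inj_onI, rule ccontr)
  fix z w
  assume z: "z \<in> closure (Omega s)" and w: "w \<in> closure (Omega s)"
    and eq: "expf r z = expf r w" and "z \<noteq> w"
  have "z \<noteq> 0 \<longleftrightarrow> w \<noteq> 0" using eq by (metis expf_eq_0_iff)
  with \<open>z \<noteq> w\<close> have nz: "z \<noteq> 0" "w \<noteq> 0" by auto
  have n1: "z \<noteq> 1" "w \<noteq> 1" using closure_Omega_neq_1[OF s] z w by auto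
  define p q where "p = - ln (norm z)" and "q = - ln (norm w)"
  have pq: "p \<ge> 0" "q \<ge> 0"
    using closure_Omega_norm[OF s z] closure_Omega_norm[OF s w] nz by (auto simp: p_def q_def)
  \<comment> \<open>\<open>a\<close> is the difference of the two exponents, so equality of the
    values becomes \<open>z = w * exp a\<close>.\<close>
  define a where "a = complex_of_real r * (w - z) / ((1 - z) * (1 - w))"
  have a_eq: "complex_of_real (r / 2) * ((1 + w) / (1 - w)) - complex_of_real (r / 2) * ((1 + z) / (1 - z)) = a"
  proof -
    have "(1 + w) / (1 - w) - (1 + z) / (1 - z) = 2 * (w - z) / ((1 - z) * (1 - w))"
      using n1 by (simp add: field_simps)
    then show ?thesis unfolding right_diff_distrib[symmetric]
      by (simp add: a_def del: right_diff_distrib_numeral)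
  qed
  have zw: "z = w * exp a"
    using eq unfolding a_eq[symmetric] exp_diff expf_def
    by (metis exp_not_eq_zero nonzero_eq_divide_eq times_divide_eq_right)
  have "a \<noteq> 0" using zw \<open>z \<noteq> w\<close> by auto
  have nzw: "norm z = norm w * exp (Re a)"
    by (subst zw) (simp add: norm_mult)
  have Re_a: "Re a = q - p"
    using nz nzw by (simp add: p_def q_def ln_mult)
  \<comment> \<open>Splitting off \<open>exp (a / 2)\<close> makes the modulus symmetric in the two
    points, since \<open>norm z = norm w * exp (Re a)\<close>.\<close>
  have "z - w = w * exp (a / 2) * (2 * sinh (a / 2))"
  proof -
    have "exp (a / 2) * (2 * sinh (a / 2)) = exp (a / 2) * exp (a / 2) - exp (a / 2) * exp (- (a / 2))"
      unfolding right_diff_distrib[symmetric] by (simp add: sinh_field_def)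
    also have "\<dots> = exp a - 1" by (simp flip: exp_add)
    finally show ?thesis by (subst zw) (simp add: right_diff_distrib mult.assoc)
  qed
  then have "(norm (z - w))\<^sup>2 = (norm w * exp (Re a / 2))\<^sup>2 * (4 * (norm (sinh (a / 2)))\<^sup>2)"
    by (simp add: norm_mult power_mult_distrib)
  also have "(norm w * exp (Re a / 2))\<^sup>2 = norm z * norm w"
    by (simp add: nzw power_mult_distrib power2_eq_square flip: exp_add)
  finally have dist: "(norm (z - w))\<^sup>2 = norm z * norm w * (4 * (norm (sinh (a / 2)))\<^sup>2)" .
  \<comment> \<open>If both points lie on the unit circle, \<open>a\<close> is purely imaginary and
    strictness comes from the sine; otherwise it comes from \<open>sinhc\<close>.\<close>
  have less: "4 * (norm (sinh (a / 2)))\<^sup>2 < sinhc p * sinhc q * (norm a)\<^sup>2"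
  proof (cases "p = 0 \<and> q = 0")
    case True
    then have "Re a = 0" using Re_a by simp
    with \<open>a \<noteq> 0\<close> have "Im a / 2 \<noteq> 0" by (auto simp: complex_eq_iff)
    then have "\<bar>sin (Im a / 2)\<bar> < \<bar>Im a / 2\<bar>" by (rule abs_sin_less_abs)
    then have "(sin (Im a / 2))\<^sup>2 < (Im a / 2)\<^sup>2"
      by (metis abs_ge_zero power2_abs power_strict_mono zero_less_numeral)
    then show ?thesis using True \<open>Re a = 0\<close>
      by (simp add: norm_sinh_squared cmod_power2[of a] sinhc_def power_divide)
  next
    case False
    have "4 * (norm (sinh (a / 2)))\<^sup>2 \<le> (sinhc ((q - p) / 2))\<^sup>2 * (norm a)\<^sup>2"
      using norm_sinh_squared_le[of "a / 2"] by (simp add: Re_a norm_divide power_divide)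
    also have "\<dots> < (sinhc p * sinhc q) * (norm a)\<^sup>2"
      using sinhc_half_diff_squared_less[of q p] pq False \<open>a \<noteq> 0\<close>
      by (intro mult_strict_right_mono) (auto simp: mult.commute)
    finally show ?thesis .
  qed
  \<comment> \<open>The factor \<open>s\<^sup>2\<close> is shared between the two points so that the
    distance bound applies to each; the product of the bounds then cancels the denominator of
    \<open>a\<close>.\<close>
  have "s\<^sup>2 * (norm (z - w))\<^sup>2 < s\<^sup>2 * (norm z * norm w * (sinhc p * sinhc q * (norm a)\<^sup>2))"
    unfolding dist using less nz s by (intro mult_strict_left_mono) auto
  also have "\<dots> = (s * norm z * sinhc p) * (s * norm w * sinhc q) * (norm a)\<^sup>2"
    by (simp add: power2_eq_square)
  also have "\<dots> \<le> (norm (1 - z))\<^sup>2 * (norm (1 - w))\<^sup>2 * (norm a)\<^sup>2"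
  proof (intro mult_right_mono mult_mono)
    show "s * norm z * sinhc p \<le> (norm (1 - z))\<^sup>2"
      unfolding p_def using s z nz(1) by (rule closure_Omega_dist_1_sinhc)
    show "s * norm w * sinhc q \<le> (norm (1 - w))\<^sup>2"
      unfolding q_def using s w nz(2) by (rule closure_Omega_dist_1_sinhc)
    show "0 \<le> s * norm w * sinhc q"
      using s sinhc_ge_1[of q] by simp
  qed simp_all
  also have "\<dots> = r\<^sup>2 * (norm (z - w))\<^sup>2"
  proof -
    have "(1 - z) * (1 - w) * a = complex_of_real r * (w - z)"
      using n1 by (simp add: a_def)
    then have "norm (1 - z) * norm (1 - w) * norm a = \<bar>r\<bar> * norm (z - w)"
      by (metis norm_minus_commute norm_mult norm_of_real)
    then show ?thesis by (metis power2_abs power_mult_distrib)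
  qed
  finally have "s\<^sup>2 < r\<^sup>2" by (rule mult_right_less_imp_less) simp
  moreover have "r\<^sup>2 \<le> s\<^sup>2" using power_mono[OF r, of 2] by simp
  ultimately show False by simp
qed

section \<open>Surjectivity and the inverse map\<close>

lemma open_Omega: "open (Omega s)"
proof -
  have "open (ball 0 1 \<inter> expf s -` ball 0 1)"
    by (intro continuous_open_preimage continuous_on_expf) auto
  then show ?thesis by (simp add: Omega_def vimage_def Int_def)
qed

lemma compact_closure_Omega: "compact (closure (Omega s))"
  by (rule compact_closure[THEN iffD2], rule bounded_subset[of "ball 0 1"]) (auto simp: Omega_def)

lemma norm_expf_frontier:
  assumes "s > 0" "z \<in> closure (Omega s)" "z \<notin> Omega s"
  shows "norm (expf s z) = 1"
proof (cases "norm z = 1")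
  case True
  then show ?thesis by (rule norm_expf_unit)
next
  case False
  then show ?thesis
    using assms(3) closure_Omega_norm[OF assms(1,2)] closure_Omega_expf[OF assms(1,2)]
    by (auto simp: Omega_def)
qed

text \<open>The image is nonempty, open by invariance of domain, and relatively closed in the
  connected disk.\<close>

lemma expf_image_Omega:
  assumes s: "s > 0"
  shows "expf s ` Omega s = ball 0 1"
proof -
  have one: "1 \<notin> Omega s" by (simp add: Omega_def)
  have cont: "continuous_on (closure (Omega s)) (expf s)"
    using closure_Omega_neq_1[OF s] by (intro continuous_on_expf) auto
  have sub: "expf s ` Omega s \<subseteq> ball 0 1" by (auto simp: Omega_def)
  have "inj_on (expf s) (Omega s)"
    using inj_on_subset[OF inj_on_expf[OF s, of s] closure_subset] s by simp
  then have "open (expf s ` Omega s)"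
    using holomorphic_on_expf[OF one] open_Omega
    by (intro invariance_of_domain holomorphic_on_imp_continuous_on)
  then have op: "openin (top_of_set (ball 0 1)) (expf s ` Omega s)"
    using sub by (simp add: open_subset)
  \<comment> \<open>Since frontier points go to the unit circle, the image is the trace on the open
    disk of the compact image of the closure.\<close>
  have "z \<in> Omega s" if "z \<in> closure (Omega s)" "expf s z \<in> ball 0 1" for z
    using norm_expf_frontier[OF s that(1)] that(2) by auto
  then have "expf s ` Omega s = ball 0 1 \<inter> expf s ` closure (Omega s)"
    using sub closure_subset[of "Omega s"] by blast
  moreover have "closed (expf s ` closure (Omega s))"
    using compact_continuous_image[OF cont compact_closure_Omega] by (rule compact_imp_closed)
  ultimately have cl: "closedin (top_of_set (ball 0 1)) (expf s ` Omega s)"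
    by (metis closedin_closed_Int)
  have "0 \<in> Omega s" by (simp add: Omega_def)
  then have "expf s ` Omega s \<noteq> {}" by blast
  then show ?thesis
    using op cl connected_ball[of "0::complex" 1] unfolding connected_clopen by blast
qed

lemma expf_image_closure_Omega:
  assumes s: "s > 0"
  shows "expf s ` closure (Omega s) = cball 0 1"
proof
  show "expf s ` closure (Omega s) \<subseteq> cball 0 1"
    using closure_Omega_expf[OF s] by auto
  have cont: "continuous_on (closure (Omega s)) (expf s)"
    using closure_Omega_neq_1[OF s] by (intro continuous_on_expf) auto
  have "closed (expf s ` closure (Omega s))"
    using compact_continuous_image[OF cont compact_closure_Omega] by (rule compact_imp_closed)
  moreover have "ball 0 1 \<subseteq> expf s ` closure (Omega s)"
    using expf_image_Omega[OF s] closure_subset[of "Omega s"] by blast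
  ultimately have "closure (ball 0 1) \<subseteq> expf s ` closure (Omega s)"
    by (rule closure_minimal[rotated])
  then show "cball 0 1 \<subseteq> expf s ` closure (Omega s)" by simp
qed

section \<open>The inverse map and its regularity\<close>

lemma chi_expf:
  assumes "s > 0" "z \<in> closure (Omega s)"
  shows "chi s (expf s z) = z"
  unfolding chi_def using assms by (intro the_inv_into_f_f inj_on_expf) auto

lemma chi_image_cball:
  assumes "s > 0"
  shows "chi s ` cball 0 1 = closure (Omega s)"
  unfolding expf_image_closure_Omega[OF assms, symmetric] image_image
  using chi_expf[OF assms] by simp

lemma chi_image_ball:
  assumes "s > 0"
  shows "chi s ` ball 0 1 = Omega s"
  unfolding expf_image_Omega[OF assms, symmetric] image_image
  using chi_expf[OF assms] closure_subset[of "Omega s"] by (simp add: subset_iff)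

lemma inj_on_chi:
  assumes "s > 0"
  shows "inj_on (chi s) (cball 0 1)"
  unfolding expf_image_closure_Omega[OF assms, symmetric] inj_on_def
  using chi_expf[OF assms] by auto

lemma continuous_on_chi:
  assumes s: "s > 0"
  shows "continuous_on (cball 0 1) (chi s)"
proof -
  have "continuous_on (closure (Omega s)) (expf s)"
    using closure_Omega_neq_1[OF s] by (intro continuous_on_expf) auto
  then have "continuous_on (expf s ` closure (Omega s)) (chi s)"
    using compact_closure_Omega chi_expf[OF s] by (intro continuous_on_inv) auto
  then show ?thesis by (simp add: expf_image_closure_Omega[OF s])
qed

text \<open>The inverse function theorem for injective holomorphic maps yields a holomorphic
  inverse, which agrees with \<open>chi s\<close> on the disk.\<close>

lemma holomorphic_on_chi:
  assumes s: "s > 0"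
  shows "chi s holomorphic_on ball 0 1"
proof -
  have "expf s holomorphic_on Omega s" by (intro holomorphic_on_expf) (simp add: Omega_def)
  moreover have "inj_on (expf s) (Omega s)"
    using inj_on_subset[OF inj_on_expf[OF s, of s] closure_subset] s by simp
  ultimately obtain g where g: "g holomorphic_on (expf s ` Omega s)"
      "\<And>z. z \<in> Omega s \<Longrightarrow> g (expf s z) = z"
    using holomorphic_has_inverse[of "expf s" "Omega s"] open_Omega by metis
  have "g holomorphic_on ball 0 1" using g(1) expf_image_Omega[OF s] by simp
  moreover have "g w = chi s w" if "w \<in> ball 0 1" for w
    using that g(2) chi_expf[OF s] closure_subset[of "Omega s"]
    unfolding expf_image_Omega[OF s, symmetric] by auto
  ultimately show ?thesis by (rule holomorphic_transform)
qed

section \<open>The value 1 is omitted\<close>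

lemma expf_neq_1:
  assumes s: "s > 0" and t: "t > 0" and st: "\<bar>s - t\<bar> \<le> s" and z: "z \<in> closure (Omega s)"
  shows "expf (s - t) z \<noteq> 1"
proof
  assume eq: "expf (s - t) z = 1"
  define d where "d = (norm (1 - z))\<^sup>2"
  have z1: "z \<noteq> 1" using closure_Omega_neq_1[OF s z] .
  then have d: "d > 0" by (simp add: d_def)
  have le1: "norm z \<le> 1" using closure_Omega_norm[OF s z] .
  \<comment> \<open>A modulus of 1 leaves no room for the damping factor, so the Poisson kernel
    cannot be positive and \<open>z\<close> lies on the unit circle.\<close>
  have "1 = norm (expf s z) * exp (- (t / 2 * ((1 - (norm z)\<^sup>2) / d)))"
    using norm_expf_diff[of s t z] by (simp add: eq d_def)
  also have "\<dots> \<le> exp (- (t / 2 * ((1 - (norm z)\<^sup>2) / d)))"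
    using closure_Omega_expf[OF s z] by simp
  finally have "1 \<le> (norm z)\<^sup>2" using t d by (simp add: zero_le_mult_iff divide_le_0_iff mult_le_0_iff)
  with le1 have nz: "norm z = 1" by (smt (verit) norm_ge_zero power_less_one_iff power2_eq_square mult_le_one mult_left_le)
  have sd: "s \<le> d" using closure_Omega_dist_1[OF s z] nz by (simp add: d_def)
  have Re0: "Re ((1 + z) / (1 - z)) = 0" by (simp only: Re_Cayley nz) simp
  have Im0: "Im ((1 + z) / (1 - z)) = 2 * Im z / d"
    by (simp add: Im_divide d_def cmod_power2) (simp add: algebra_simps)
  define b where "b = (s - t) * Im z / d"
  have "(1 + z) / (1 - z) = \<i> * complex_of_real (2 * Im z / d)"
    using Re0 Im0 by (simp add: complex_eq_iff)
  then have "complex_of_real ((s - t) / 2) * ((1 + z) / (1 - z)) = \<i> * complex_of_real b"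
    by (simp only:) (simp add: b_def)
  then have zb: "z * exp (\<i> * complex_of_real b) = 1"
    using eq unfolding expf_def by (simp only:)
  then have "z = exp (- (\<i> * complex_of_real b))"
    by (simp add: exp_minus field_simps)
  then have "Im z = - sin b" by (simp add: Im_exp)
  moreover have "b \<noteq> 0" using zb z1 by auto
  \<comment> \<open>The contradiction is |Im z| = |sin b| < |b| \<le> |Im z|, where the last
    inequality follows from \<open>\<bar>s - t\<bar> \<le> s \<le> d\<close>.\<close>
  ultimately have "\<bar>Im z\<bar> < \<bar>b\<bar>" using abs_sin_less_abs by simp
  moreover have "\<bar>b\<bar> = \<bar>s - t\<bar> / d * \<bar>Im z\<bar>"
    using d by (simp add: b_def abs_mult)
  moreover have "\<bar>s - t\<bar> / d * \<bar>Im z\<bar> \<le> 1 * \<bar>Im z\<bar>"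
    using d st sd by (intro mult_right_mono) auto
  ultimately show False by simp
qed

theorem proposition4p4:
  fixes s t :: real
  assumes "s > 0" and "t > 0"
  shows "expf (s - t) ` closure (Omega s) \<subseteq> closure (ball 0 1) \<and>
    (s \<ge> t / 2 \<longrightarrow>
       injective_conformal_on (chi2 s t) (ball 0 1) \<and>
       chi2 s t ` ball 0 1 \<subseteq> ball 0 1 \<and>
       (\<exists>g h. (\<forall>z\<in>ball 0 1. g z = chi2 s t z) \<and>
          homeomorphism (closure (ball 0 1)) (closure (chi2 s t ` ball 0 1)) g h) \<and>
       1 \<notin> closure (chi2 s t ` ball 0 1))"
proof (rule conjI, goal_cases)
  case 1
  have "norm (expf (s - t) z) \<le> 1" if "z \<in> closure (Omega s)" for z
    using norm_expf_diff_le[OF assms(2)] closure_Omega_norm[OF assms(1) that]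
      closure_Omega_expf[OF assms(1) that] order_trans by blast
  then show ?case by auto
next
  case 2
  show ?case
  proof
    assume "s \<ge> t / 2"
    then have st: "\<bar>s - t\<bar> \<le> s" using assms by (auto simp: abs_le_iff)
    have 1: "1 \<notin> closure (Omega s)" using closure_Omega_neq_1[OF assms(1)] by blast
    have inj: "inj_on (chi2 s t) (cball 0 1)"
      unfolding chi2_def
      using inj_on_chi inj_on_expf st assms by (intro comp_inj_on) (auto simp: chi_image_cball)
    have cont: "continuous_on (cball 0 1) (chi2 s t)"
      unfolding chi2_def using continuous_on_chi assms 1
      by (intro continuous_on_compose continuous_on_expf) (auto simp: chi_image_cball)
    have hol: "chi2 s t holomorphic_on ball 0 1"
      unfolding chi2_def using holomorphic_on_chi assms
      by (intro holomorphic_on_compose holomorphic_on_expf) (auto simp: chi_image_ball Omega_def)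
    have injb: "inj_on (chi2 s t) (ball 0 1)"
      using inj ball_subset_cball by (rule inj_on_subset)
    have conf: "injective_conformal_on (chi2 s t) (ball 0 1)"
      unfolding injective_conformal_on_def
      using hol injb holomorphic_injective_imp_regular[OF hol _ injb] by auto
    have sub: "chi2 s t ` ball 0 1 \<subseteq> ball 0 1"
    proof -
      have "norm (expf (s - t) z) < 1" if "z \<in> Omega s" for z
        using norm_expf_diff_le[OF assms(2), of z s] that by (auto simp: Omega_def)
      then show ?thesis
        unfolding chi2_def image_comp[symmetric] chi_image_ball[OF assms(1)] by auto
    qed
    \<comment> \<open>By compactness the closure of the image is the image of the closed disk, so
      \<open>chi2 s t\<close> itself serves as the extension \<open>g\<close>.\<close>
    have im: "closure (chi2 s t ` ball 0 1) = chi2 s t ` cball 0 1"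
    proof
      have "closed (chi2 s t ` cball 0 1)"
        using compact_continuous_image[OF cont compact_cball] by (rule compact_imp_closed)
      then show "closure (chi2 s t ` ball 0 1) \<subseteq> chi2 s t ` cball 0 1"
        by (intro closure_minimal) auto
      show "chi2 s t ` cball 0 1 \<subseteq> closure (chi2 s t ` ball 0 1)"
        using image_closure_subset[OF _ closed_closure closure_subset, of "ball 0 1" "chi2 s t"]
          cont by simp
    qed
    have "\<exists>h. homeomorphism (cball 0 1) (chi2 s t ` cball 0 1) (chi2 s t) h"
      using homeomorphism_compact[OF compact_cball cont refl inj] by blast
    moreover have "1 \<notin> chi2 s t ` cball 0 1"
      using expf_neq_1[OF assms st]
      unfolding chi2_def image_comp[symmetric] chi_image_cball[OF assms(1)] by (metis imageE)
    ultimately show "injective_conformal_on (chi2 s t) (ball 0 1) \<and>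
       chi2 s t ` ball 0 1 \<subseteq> ball 0 1 \<and>
       (\<exists>g h. (\<forall>z\<in>ball 0 1. g z = chi2 s t z) \<and>
          homeomorphism (closure (ball 0 1)) (closure (chi2 s t ` ball 0 1)) g h) \<and>
       1 \<notin> closure (chi2 s t ` ball 0 1)"
      using conf sub unfolding im by auto
  qed
qed

end
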